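(* Let $\Omega$ be a non-empty open subset of $\ell^2$. If $\Omega$ has a Lipschitz continuous boundary, then $\Omega$ satisfies the strong segment condition.
   Context: $\ell^2$ is the real Hilbert space of square-summable sequences indexed by $\mathbb{N}$, with norm $\|\cdot\|$. Fix positive numbers $(a_i)_{i\ge1}$ with $\sum_i a_i<\infty$. $\widetilde H=\{\mathbf x=(x_i)\in\ell^2:\sum_i x_i^2/a_i^4<\infty\}$. $P_{\mathbb{N}\setminus\{1\}}:\ell^2\to\ell^2(\mathbb{N}\setminus\{1\})$ is the map deleting the first coordinate. Lipschitz continuous boundary: for every $\mathbf x_0\in\partial\Omega$ there exist a surjective isometry $T:\ell^2\to\ell^2$ (i.e. $T\ell^2=\ell^2$ and $\|T\mathbf y-T\mathbf y'\|=\|\mathbf y-\mathbf y'\|$) with $T\mathbf x_0=\mathbf 0$, an open neighbourhood $U_{\mathbf x_0}$ of $\mathbf x_0$, and a Lipschitz continuous function $f:P_{\mathbb{N}\setminus\{1\}}TU_{\mathbf x_0}\to\mathbb{R}$ such that $T(U_{\mathbf x_0}\cap\Omega)=\{\mathbf y\in TU_{\mathbf x_0}:y_1<f(P_{\mathbb{N}\setminus\{1\}}\mathbf y)\}$ and $T(U_{\mathbf x_0}\cap\partial\Omega)=\{\mathbf y\in TU_{\mathbf x_0}:y_1=f(P_{\mathbb{N}\setminus\{1\}}\mathbf y)\}$. Strong segment condition: for every $\mathbf x\in\partial\Omega$ there exist a neighbourhood $U_{\mathbf x}\subset\ell^2$ of $\mathbf x$ and a nonzero vector $\mathbf y_{\mathbf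 x}\in\widetilde H$ such that $\mathbf z+t\mathbf y_{\mathbf x}\in\Omega$ for all $\mathbf z\in\overline\Omega\cap U_{\mathbf x}$ and all $t\in(0,1)$. *)

theory Defs
  imports "HOL-Analysis.Analysis"
begin

text \<open>
  The real Hilbert space of square-summable sequences. The index set is \<^typ>\<open>nat\<close> starting at
  0, so the coordinate written $x_1$ in one-based notation is \<open>coord x 0\<close>.
\<close>

typedef ell2 = "{x :: nat \<Rightarrow> real. summable (\<lambda>i. (x i)\<^sup>2)}"
  morphisms coord Abs_ell2
  by (rule exI[of _ "\<lambda>_. 0"]) simp

setup_lifting type_definition_ell2

lemma summable_coord_square: "summable (\<lambda>i. (coord x i)\<^sup>2)"
  using coord[of x] by simp

lemma summable_mult_of_squares:
  fixes x y :: "nat \<Rightarrow> real"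
  assumes "summable (\<lambda>i. (x i)\<^sup>2)" and "summable (\<lambda>i. (y i)\<^sup>2)"
  shows "summable (\<lambda>i. x i * y i)"
proof (rule summable_comparison_test'[of "\<lambda>i. (x i)\<^sup>2 + (y i)\<^sup>2" 0])
  show "summable (\<lambda>i. (x i)\<^sup>2 + (y i)\<^sup>2)"
    using assms by (rule summable_add)
  fix i
  have "2 * (\<bar>x i\<bar> * \<bar>y i\<bar>) \<le> (x i)\<^sup>2 + (y i)\<^sup>2"
    using sum_squares_bound[of "\<bar>x i\<bar>" "\<bar>y i\<bar>"] by simp
  moreover have "0 \<le> \<bar>x i\<bar> * \<bar>y i\<bar>" by simp
  ultimately show "norm (x i * y i) \<le> (x i)\<^sup>2 + (y i)\<^sup>2"
    unfolding real_norm_def abs_mult by linarith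
qed

lemma summable_add_square:
  fixes x y :: "nat \<Rightarrow> real"
  assumes "summable (\<lambda>i. (x i)\<^sup>2)" and "summable (\<lambda>i. (y i)\<^sup>2)"
  shows "summable (\<lambda>i. (x i + y i)\<^sup>2)"
proof -
  have "summable (\<lambda>i. (x i)\<^sup>2 + (y i)\<^sup>2 + 2 * (x i * y i))"
    by (intro summable_add summable_mult summable_mult_of_squares assms)
  then show ?thesis by (simp add: power2_sum mult.assoc)
qed

instantiation ell2 :: real_vector
begin

lift_definition zero_ell2 :: ell2 is "\<lambda>_. 0" by simp

lift_definition uminus_ell2 :: "ell2 \<Rightarrow> ell2" is "\<lambda>x i. - x i" by simp

lift_definition plus_ell2 :: "ell2 \<Rightarrow> ell2 \<Rightarrow> ell2" is "\<lambda>x y i. x i + y i"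
  by (rule summable_add_square)

lift_definition minus_ell2 :: "ell2 \<Rightarrow> ell2 \<Rightarrow> ell2" is "\<lambda>x y i. x i - y i"
  subgoal for x y using summable_add_square[of x "\<lambda>i. - y i"] by simp
  done

lift_definition scaleR_ell2 :: "real \<Rightarrow> ell2 \<Rightarrow> ell2" is "\<lambda>c x i. c * x i"
  by (simp add: power_mult_distrib summable_mult)

instance
  by standard (transfer; simp add: fun_eq_iff algebra_simps)+

end

instantiation ell2 :: real_inner
begin

definition inner_ell2 :: "ell2 \<Rightarrow> ell2 \<Rightarrow> real" where
  "inner_ell2 x y = (\<Sum>i. coord x i * coord y i)"

definition norm_ell2 :: "ell2 \<Rightarrow> real" where
  "norm_ell2 x = sqrt (inner x x)"

definition dist_ell2 :: "ell2 \<Rightarrow> ell2 \<Rightarrow> real" where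
  "dist_ell2 x y = norm (x - y)"

definition sgn_ell2 :: "ell2 \<Rightarrow> ell2" where
  "sgn_ell2 x = x /\<^sub>R norm x"

definition uniformity_ell2 :: "(ell2 \<times> ell2) filter" where
  "uniformity_ell2 = (INF e\<in>{0<..}. principal {(x, y). dist x y < e})"

definition open_ell2 :: "ell2 set \<Rightarrow> bool" where
  "open_ell2 U \<longleftrightarrow> (\<forall>x\<in>U. eventually (\<lambda>(x', y). x' = x \<longrightarrow> y \<in> U) uniformity)"

instance
proof
  fix x y z :: ell2 and r :: real and U :: "ell2 set"
  have summ: "summable (\<lambda>i. coord u i * coord v i)" for u v
    by (intro summable_mult_of_squares summable_coord_square)
  show "dist x y = norm (x - y)" by (rule dist_ell2_def)
  show "sgn x = x /\<^sub>R norm x" by (rule sgn_ell2_def)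
  show "uniformity = (INF e\<in>{0<..}. principal {(x :: ell2, y). dist x y < e})"
    by (rule uniformity_ell2_def)
  show "open U \<longleftrightarrow> (\<forall>x\<in>U. eventually (\<lambda>(x', y). x' = x \<longrightarrow> y \<in> U) uniformity)"
    by (rule open_ell2_def)
  show "inner x y = inner y x"
    by (simp add: inner_ell2_def mult.commute)
  show "inner (x + y) z = inner x z + inner y z"
    using suminf_add[OF summ[of x z] summ[of y z]]
    by (simp add: inner_ell2_def plus_ell2.rep_eq distrib_right)
  show "inner (r *\<^sub>R x) y = r * inner x y"
    using suminf_mult[OF summ[of x y], of r]
    by (simp add: inner_ell2_def scaleR_ell2.rep_eq mult.assoc)
  show "0 \<le> inner x x"
    unfolding inner_ell2_def by (rule suminf_nonneg[OF summ]) simp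
  show "inner x x = 0 \<longleftrightarrow> x = 0"
    using suminf_eq_zero_iff[OF summ[of x x]]
    by (simp add: inner_ell2_def coord_inject[symmetric] zero_ell2.rep_eq fun_eq_iff)
  show "norm x = sqrt (inner x x)" by (rule norm_ell2_def)
qed

end

lemma norm_ell2_eq: "norm x = sqrt (\<Sum>i. (coord x i)\<^sup>2)"
  by (simp add: norm_ell2_def inner_ell2_def power2_eq_square)

text \<open>
  Deletion of the first coordinate. The sequences indexed by the remaining indices 1, 2, ...
  are re-indexed from 0; this identifies the square-summable ones isometrically with
  \<^typ>\<open>ell2\<close>.
\<close>

lift_definition delete_first :: "ell2 \<Rightarrow> ell2" is "\<lambda>x i. x (Suc i)"
  subgoal for x using summable_Suc_iff[of "\<lambda>i. (x i)\<^sup>2"] by simp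
  done

definition H_tilde :: "(nat \<Rightarrow> real) \<Rightarrow> ell2 set" where
  "H_tilde a = {x. summable (\<lambda>i. (coord x i)\<^sup>2 / (a i) ^ 4)}"

text \<open>
  The graph function \<open>f\<close> is total here; only its values on \<open>delete_first ` T ` U\<close> are constrained.
\<close>

definition lipschitz_boundary :: "ell2 set \<Rightarrow> bool" where
  "lipschitz_boundary \<Omega> \<longleftrightarrow>
    (\<forall>x0\<in>frontier \<Omega>. \<exists>(T :: ell2 \<Rightarrow> ell2) U (f :: ell2 \<Rightarrow> real).
       surj T \<and> (\<forall>y y'. norm (T y - T y') = norm (y - y')) \<and> T x0 = 0 \<and>
       open U \<and> x0 \<in> U \<and>
       (\<exists>L. L-lipschitz_on (delete_first ` T ` U) f) \<and>
       T ` (U \<inter> \<Omega>) = {y \<in> T ` U. coord y 0 < f (delete_first y)} \<and>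
       T ` (U \<inter> frontier \<Omega>) = {y \<in> T ` U. coord y 0 = f (delete_first y)})"

definition strong_segment_condition :: "(nat \<Rightarrow> real) \<Rightarrow> ell2 set \<Rightarrow> bool" where
  "strong_segment_condition a \<Omega> \<longleftrightarrow>
    (\<forall>x\<in>frontier \<Omega>. \<exists>U v. x \<in> interior U \<and> v \<in> H_tilde a \<and> v \<noteq> 0 \<and>
       (\<forall>z \<in> closure \<Omega> \<inter> U. \<forall>t\<in>{0<..<1}. z + t *\<^sub>R v \<in> \<Omega>))"

end

theory Submission
  imports Defs
begin

text \<open>
  In the coordinates given by \<open>T\<close>, the set \<open>\<Omega>\<close> is locally the subgraph of an \<open>L\<close>-Lipschitz function,
  so every direction \<open>- e\<^sub>0 + r\<close> with \<open>(1 + L) \<parallel>r\<parallel> < 1\<close> points strictly into \<open>\<Omega>\<close> from all nearby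
  points of the closure. Since \<open>T\<close> is affine and \<open>H_tilde a\<close> is dense (it contains the finitely
  supported sequences), such a direction can be realised by a vector of \<open>H_tilde a\<close>.
\<close>

lemma abs_coord_le_norm: "\<bar>coord x i\<bar> \<le> norm x"
proof -
  have "(coord x i)\<^sup>2 \<le> (\<Sum>i. (coord x i)\<^sup>2)"
    using sum_le_suminf[OF summable_coord_square, of "{i}" x] by simp
  then show ?thesis
    unfolding norm_ell2_eq by (metis real_sqrt_abs real_sqrt_le_iff)
qed

lemma norm_delete_first_le: "norm (delete_first x) \<le> norm x"
  unfolding norm_ell2_eq delete_first.rep_eq real_sqrt_le_iff
  using suminf_split_head[OF summable_coord_square[of x]] zero_le_power2[of "coord x 0"]
  by linarith

lemma delete_first_diff: "delete_first (x - y) = delete_first x - delete_first y"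
  by transfer simp

lift_definition truncation :: "nat \<Rightarrow> ell2 \<Rightarrow> ell2" is "\<lambda>n x i. if i < n then x i else 0"
  subgoal for n x by (rule summable_finite[of "{..<n}"]) auto
  done

lemma truncation_in_H_tilde: "truncation n x \<in> H_tilde a"
  unfolding H_tilde_def mem_Collect_eq truncation.rep_eq
  by (rule summable_finite[of "{..<n}"]) auto

text \<open>The squared distance from \<open>truncation n w\<close> to \<open>w\<close> is the tail
  from index \<open>n\<close> of the convergent series of squares of \<open>w\<close>, so a large
  \<open>n\<close> makes it smaller than the square of \<open>\<epsilon>\<close>.\<close>

lemma H_tilde_dense:
  assumes "\<epsilon> > 0"
  obtains v where "v \<in> H_tilde a" and "norm (v - w) < \<epsilon>"
proof -
  obtain n where n: "norm (\<Sum>i. (coord w (i + n))\<^sup>2) < \<epsilon>\<^sup>2"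
    using suminf_exist_split[OF _ summable_coord_square, of "\<epsilon>\<^sup>2" w] assms by auto
  let ?r = "\<lambda>i. (coord (truncation n w - w) i)\<^sup>2"
  have "(\<Sum>i. ?r i) = (\<Sum>i. ?r (i + n))"
    using suminf_minus_initial_segment[OF summable_coord_square, of "truncation n w - w" n]
    by (simp add: minus_ell2.rep_eq truncation.rep_eq)
  also have "\<dots> = (\<Sum>i. (coord w (i + n))\<^sup>2)"
    by (simp add: minus_ell2.rep_eq truncation.rep_eq)
  also have "\<dots> < \<epsilon>\<^sup>2" using n by simp
  finally have "norm (truncation n w - w) < \<epsilon>"
    unfolding norm_ell2_eq using assms by (simp add: real_less_lsqrt)
  with truncation_in_H_tilde show thesis by (rule that)
qed

lemma H_tilde_scaleR: "x \<in> H_tilde a \<Longrightarrow> c *\<^sub>R x \<in> H_tilde a"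
  by (auto simp: H_tilde_def scaleR_ell2.rep_eq power_mult_distrib
      simp flip: times_divide_eq_right intro: summable_mult)

theorem proposition6p16:
  fixes a :: "nat \<Rightarrow> real" and \<Omega> :: "ell2 set"
  assumes "\<And>i. a i > 0" and "summable a"
    and "open \<Omega>" and "\<Omega> \<noteq> {}"
    and "lipschitz_boundary \<Omega>"
  shows "strong_segment_condition a \<Omega>"
  unfolding strong_segment_condition_def
proof
  fix x0 assume "x0 \<in> frontier \<Omega>"
  with assms(5) obtain T :: "ell2 \<Rightarrow> ell2" and U f L where
    "surj T" and iso: "\<And>y y'. norm (T y - T y') = norm (y - y')" and "T x0 = 0"
    and "open U" "x0 \<in> U" and lip: "L-lipschitz_on (delete_first ` T ` U) f"
    and subgraph: "T ` (U \<inter> \<Omega>) = {y \<in> T ` U. coord y 0 < f (delete_first y)}"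
    and graph: "T ` (U \<inter> frontier \<Omega>) = {y \<in> T ` U. coord y 0 = f (delete_first y)}"
    unfolding lipschitz_boundary_def by meson
  have "L \<ge> 0" using lip by (rule lipschitz_on_nonneg)
  have "inj T"
    by (rule injI) (use iso in \<open>metis norm_eq_zero right_minus_eq\<close>)
  \<comment> \<open>\<open>S\<close> is the linear part of \<open>T\<close>: it is an isometry that
    fixes 0, and in a real inner product space such a map is linear.\<close>
  define S where "S = (\<lambda>u. T (x0 + u))"
  have "linear S"
    by (rule isometry_linear) (simp_all add: S_def dist_norm iso \<open>T x0 = 0\<close>)
  have T_add: "T (z + u) = T z + S u" for z u
    using linear_add[OF \<open>linear S\<close>, of "z - x0" u] by (simp add: S_def add.assoc[symmetric])
  have norm_S: "norm (S u) = norm u" for u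
    using iso[of "x0 + u" x0] by (simp add: S_def \<open>T x0 = 0\<close>)
  obtain e where e: "coord e = (\<lambda>i. if i = 0 then 1 else 0)"
  proof (rule that)
    show "coord (Abs_ell2 (\<lambda>i. if i = 0 then 1 else 0)) = (\<lambda>i. if i = 0 then 1 else 0)"
      by (rule Abs_ell2_inverse, rule CollectI, rule summable_finite[of "{0}"]) auto
  qed
  have "delete_first e = 0" by (simp flip: coord_inject add: delete_first.rep_eq e zero_ell2.rep_eq)
  \<comment> \<open>The preimage of the straight downward direction. It may lie outside
    \<open>H_tilde a\<close>, so \<open>v\<close> below only approximates it.\<close>
  obtain w where w: "S w = - e"
  proof -
    obtain y where "- e = T y" using \<open>surj T\<close> by (rule surjE)
    then have "S (y - x0) = - e" by (simp add: S_def)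
    then show thesis by (rule that)
  qed
  \<comment> \<open>An error \<open>r\<close> of size below \<open>\<epsilon>\<close> costs at most
    \<open>\<epsilon>\<close> vertically and \<open>L * \<epsilon>\<close> through the slope of
    \<open>f\<close>, together less than the unit descent along \<open>- e\<close>.\<close>
  define \<epsilon> where "\<epsilon> = 1 / (2 + L)"
  have "\<epsilon> > 0" "(1 + L) * \<epsilon> < 1" using \<open>L \<ge> 0\<close> by (simp_all add: \<epsilon>_def)
  obtain v where "v \<in> H_tilde a" and v: "norm (v - w) < \<epsilon>"
    using H_tilde_dense[OF \<open>\<epsilon> > 0\<close>] .
  define r where "r = S (v - w)"
  have "norm r < \<epsilon>" using v by (simp add: r_def norm_S)
  have Sv: "S v = r - e"
    using linear_diff[OF \<open>linear S\<close>, of v w] w by (simp add: r_def)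
  \<comment> \<open>Along \<open>S v\<close> the first coordinate falls faster than an
    \<open>L\<close>-Lipschitz graph can. As \<open>e\<close> has no horizontal part, all sideways
    motion comes from \<open>r\<close>.\<close>
  have down: "coord (S v) 0 + L * norm (delete_first (S v)) < 0"
  proof -
    have "delete_first (S v) = delete_first r"
      by (simp add: Sv delete_first_diff \<open>delete_first e = 0\<close>)
    then have "L * norm (delete_first (S v)) \<le> L * \<epsilon>"
      using norm_delete_first_le[of r] \<open>norm r < \<epsilon>\<close> \<open>L \<ge> 0\<close> by (intro mult_left_mono) auto
    moreover have "coord (S v) 0 \<le> \<epsilon> - 1"
      using abs_coord_le_norm[of r 0] \<open>norm r < \<epsilon>\<close> by (simp add: Sv minus_ell2.rep_eq e)
    ultimately show ?thesis using \<open>(1 + L) * \<epsilon> < 1\<close> by (simp add: distrib_right)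
  qed
  \<comment> \<open>Both end points must lie in \<open>U\<close>, since \<open>f\<close> is
    controlled only on \<open>delete_first\<close> T \<open>U\<close>. The strict inequality
    \<open>down\<close> carries even boundary points into the open subgraph.\<close>
  have step: "z + s *\<^sub>R v \<in> \<Omega>"
    if "z \<in> closure \<Omega>" "z \<in> U" "z + s *\<^sub>R v \<in> U" "s > 0" for z s
  proof -
    let ?y = "T (z + s *\<^sub>R v)"
    have y: "?y = T z + s *\<^sub>R S v" by (simp add: T_add linear_cmul[OF \<open>linear S\<close>])
    have "z \<in> \<Omega> \<or> z \<in> frontier \<Omega>"
      using \<open>z \<in> closure \<Omega>\<close> \<open>open \<Omega>\<close> by (auto simp: frontier_def interior_open)
    then have "T z \<in> T ` (U \<inter> \<Omega>) \<union> T ` (U \<inter> frontier \<Omega>)"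
      using \<open>z \<in> U\<close> by blast
    then have "coord (T z) 0 \<le> f (delete_first (T z))"
      unfolding subgraph graph by auto
    also have "\<dots> \<le> f (delete_first ?y) + L * norm (delete_first ?y - delete_first (T z))"
      using lipschitz_on_normD[OF lip, of "delete_first ?y" "delete_first (T z)"] that by auto
    also have "delete_first ?y - delete_first (T z) = s *\<^sub>R delete_first (S v)"
      by (simp flip: coord_inject add: y fun_eq_iff delete_first.rep_eq minus_ell2.rep_eq
          plus_ell2.rep_eq scaleR_ell2.rep_eq)
    finally have "coord ?y 0 \<le>
        f (delete_first ?y) + s * (coord (S v) 0 + L * norm (delete_first (S v)))"
      using \<open>s > 0\<close> by (simp add: y plus_ell2.rep_eq scaleR_ell2.rep_eq algebra_simps)
    also have "\<dots> < f (delete_first ?y)"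
      using mult_pos_neg[OF \<open>s > 0\<close> down] by simp
    finally have "?y \<in> T ` (U \<inter> \<Omega>)"
      unfolding subgraph using \<open>z + s *\<^sub>R v \<in> U\<close> by simp
    then show ?thesis using \<open>inj T\<close> by (auto dest: injD)
  qed
  obtain \<rho> where "\<rho> > 0" and \<rho>: "ball x0 \<rho> \<subseteq> U"
    using \<open>open U\<close> \<open>x0 \<in> U\<close> open_contains_ball by blast
  \<comment> \<open>For \<open>v = 0\<close> the inequality \<open>down\<close> would read 0 <
    0.\<close>
  have "v \<noteq> 0" 
    using down delete_first_diff[of 0 0] by (auto simp: linear_0[OF \<open>linear S\<close>] zero_ell2.rep_eq)
  \<comment> \<open>The rescaled vector has norm \<open>\<rho> / 2\<close>, so the open segments
    starting in the ball of radius \<open>\<rho> / 2\<close> stay in \<open>ball x0 \<rho>\<close>,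
    hence in \<open>U\<close>.\<close>
  define \<delta> where "\<delta> = \<rho> / (2 * norm v)"
  have "\<delta> > 0" using \<open>\<rho> > 0\<close> \<open>v \<noteq> 0\<close> by (simp add: \<delta>_def)
  show "\<exists>U v. x0 \<in> interior U \<and> v \<in> H_tilde a \<and> v \<noteq> 0 \<and>
      (\<forall>z\<in>closure \<Omega> \<inter> U. \<forall>t\<in>{0<..<1}. z + t *\<^sub>R v \<in> \<Omega>)"
  proof (intro exI conjI ballI)
    show "x0 \<in> interior (ball x0 (\<rho> / 2))"
      using \<open>\<rho> > 0\<close> by (simp add: interior_open)
    show "\<delta> *\<^sub>R v \<in> H_tilde a" using \<open>v \<in> H_tilde a\<close> by (rule H_tilde_scaleR)
    show "\<delta> *\<^sub>R v \<noteq> 0" using \<open>\<delta> > 0\<close> \<open>v \<noteq> 0\<close> by simp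
    fix z t assume z: "z \<in> closure \<Omega> \<inter> ball x0 (\<rho> / 2)" and t: "t \<in> {0<..<1::real}"
    have "norm ((t * \<delta>) *\<^sub>R v) = t * (\<rho> / 2)"
      using t \<open>\<rho> > 0\<close> \<open>v \<noteq> 0\<close> by (simp add: \<delta>_def)
    also have "\<dots> < \<rho> / 2" using t \<open>\<rho> > 0\<close> by simp
    finally have "dist z (z + (t * \<delta>) *\<^sub>R v) < \<rho> / 2"
      by (simp add: dist_norm)
    with z have "z \<in> ball x0 \<rho>" "z + (t * \<delta>) *\<^sub>R v \<in> ball x0 \<rho>"
      using dist_triangle[of x0 "z + (t * \<delta>) *\<^sub>R v" z] \<open>\<rho> > 0\<close> by auto
    then have "z \<in> U" "z + (t * \<delta>) *\<^sub>R v \<in> U"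
      using \<rho> by blast+
    then show "z + t *\<^sub>R \<delta> *\<^sub>R v \<in> \<Omega>"
      using step[of z "t * \<delta>"] z t \<open>\<delta> > 0\<close> by simp
  qed
qed

end
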